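(* Let $n\ge3$ be an odd integer. Then $$259\,\tau(n)=-\tfrac{1}{2^3}\sum_{d\mid n,\,d>0}d^{11}+\tfrac{691}{2^3\cdot3^2}\sum_{d\mid n,\,d>0}d^3\left(17+8d^2+2d^4\right)$$ $$\qquad-\tfrac{691\cdot2^2}{3^2}\sum_{\substack{m_1>m_2\ge1\\ m_1+m_2\le n\\ \gcd(m_1,m_2)\mid n}}(-1)^{m_1+m_2}(m_1m_2)^3(m_1^2-m_2^2)^2\sum_{\substack{y_1,y_2\ge1\\ m_1y_1+m_2y_2=n}}1 ,$$ where $m_1,m_2,y_1,y_2$ range over integers.
   Context: Ramanujan's tau function $\tau(n)$ is defined by $q\prod_{r\ge1}(1-q^r)^{24}=\sum_{n=1}^{\infty}\tau(n)q^n$. *)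

theory Defs
  imports "HOL-Analysis.Analysis"
begin

text \<open>The product is taken in the \<open>q\<close>-adic topology on \<^typ>\<open>int fps\<close>. Indices of \<^const>\<open>prodinf\<close>
  start at \<open>0\<close>, so the factor at index \<open>r\<close> is the usual one for \<open>r + 1\<close>.\<close>

definition ramanujan_tau :: "nat \<Rightarrow> int" where
  "ramanujan_tau n = fps_nth (fps_X * (\<Prod>r. (1 - fps_X ^ Suc r) ^ 24)) n"

text \<open>As \<^const>\<open>prodinf\<close> is a definite description, it denotes the product only if the product
  converges.\<close>

lemma fps_nth_mult_one_minus_X_power:
  fixes f :: "'a :: comm_ring_1 fps"
  assumes "n < k"
  shows "fps_nth (f * (1 - fps_X ^ k) ^ m) n = fps_nth f n"
proof (induction m)
  case (Suc m)
  let ?g = "f * (1 - fps_X ^ k) ^ m"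
  have "f * (1 - fps_X ^ k) ^ Suc m = ?g - ?g * fps_X ^ k"
    by (simp only: power_Suc2 mult.assoc [symmetric] right_diff_distrib mult_1_right)
  hence "fps_nth (f * (1 - fps_X ^ k) ^ Suc m) n = fps_nth ?g n - fps_nth (?g * fps_X ^ k) n"
    by (simp only: fps_sub_nth)
  also have "\<dots> = fps_nth ?g n"
    using assms by (simp only: fps_X_power_mult_right_nth if_True diff_zero)
  also have "\<dots> = fps_nth f n"
    by (fact Suc.IH)
  finally show ?case .
qed (simp only: power_0 mult_1_right)

lemma ramanujan_tau_product_converges:
  "(\<lambda>r. (1 - fps_X ^ Suc r) ^ 24 :: int fps) has_prod (\<Prod>r. (1 - fps_X ^ Suc r) ^ 24)"
proof -
  define F :: "nat \<Rightarrow> int fps" where "F N = (\<Prod>r\<le>N. (1 - fps_X ^ Suc r) ^ 24)" for N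
  define P where "P = Abs_fps (\<lambda>n. fps_nth (F n) n)"
  have stable: "fps_nth (F N) n = fps_nth (F n) n" if "n \<le> N" for N n
    using that
  proof (induction N rule: dec_induct)
    case (step N)
    have "F (Suc N) = F N * (1 - fps_X ^ Suc (Suc N)) ^ 24"
      by (simp only: F_def prod.atMost_Suc)
    moreover have "n < Suc (Suc N)"
      using step.hyps by simp
    ultimately show ?case
      using step.IH by (simp only: fps_nth_mult_one_minus_X_power)
  qed simp
  have "F \<longlonglongrightarrow> P"
  proof (rule tendsto_fpsI)
    fix n show "eventually (\<lambda>N. fps_nth (F N) n = fps_nth P n) sequentially"
      using eventually_ge_at_top[of n] by eventually_elim (unfold P_def fps_nth_Abs_fps, rule stable)
  qed
  moreover have "fps_nth P 0 = 1"
    by (simp add: P_def F_def fps_power_zeroth)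
  hence "P \<noteq> 0" by auto
  ultimately have "(\<lambda>r. (1 - fps_X ^ Suc r) ^ 24) has_prod P"
    unfolding has_prod_def raw_has_prod_def F_def add_0_right by blast
  with has_prod_unique [OF this] show ?thesis by (simp only:)
qed

end

theory Submission
  imports Defs
begin

text \<open>
  Write \<open>u\<^sub>m = q\<^sup>m / (1 - q\<^sup>m)\<close> (below \<open>geom m\<close>). The relation
  \<open>u\<^sub>m u\<^sub>k = u\<^sub>m\<^sub>+\<^sub>k (1 + u\<^sub>m + u\<^sub>k)\<close>, summed against the forms
  \<open>s\<^sup>j p\<^sup>2\<^sup>i\<close> with \<open>s = a\<^sup>2 + a b + b\<^sup>2\<close> and \<open>p = a b (a + b)\<close>, evaluates the convolutions of
  divisor sums that amount to Ramanujan's differential equations for \<open>E2, E4, E6\<close>, to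
  \<open>E8 = E4\<^sup>2\<close> and to \<open>691 E12 = 441 E4\<^sup>3 + 250 E6\<^sup>2\<close>. Logarithmic differentiation of the product
  gives \<open>q \<Delta>' = E2 \<Delta>\<close>, an equation that \<open>E4\<^sup>3 - E6\<^sup>2\<close> satisfies too.

  The double sum over \<open>m\<^sub>1 > m\<^sub>2\<close> is half of a symmetric one, so it is a coefficient of
  \<open>T\<^sub>7 T\<^sub>3 - T\<^sub>5\<^sup>2\<close>, where \<open>T\<^sub>k(q) = 2\<^sup>k\<^sup>+\<^sup>1 S\<^sub>k(q\<^sup>2) - S\<^sub>k(q)\<close> and \<open>S\<^sub>k\<close> generates the divisor sums.
  Everything involved is thus a polynomial in \<open>E4\<close> and \<open>2 E2(q\<^sup>2) - E2(q)\<close>, and the asserted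
  identity holds up to a series in \<open>q\<^sup>2\<close>, which does not contribute for odd \<open>n\<close>.
\<close>

section \<open>The derivation q d/dq on formal power series\<close>

definition qD :: "'a::comm_ring_1 fps \<Rightarrow> 'a fps"
  where "qD f = fps_X * fps_deriv f"

lemma qD_nth: "fps_nth (qD f) n = of_nat n * fps_nth f n"
  by (simp add: qD_def fps_mult_fps_X_deriv_shift)

lemma qD_add: "qD (f + g) = qD f + qD g"
  and qD_diff: "qD (f - g) = qD f - qD g"
  and qD_mult: "qD (f * g) = qD f * g + f * qD g"
  and qD_1: "qD 1 = 0"
  and qD_numeral: "qD (numeral k) = 0"
  by (simp_all add: qD_def algebra_simps)

lemma qD_power: "qD (f ^ k) = of_nat k * f ^ (k - 1) * qD f"
  by (simp add: qD_def fps_deriv_power' mult_ac)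

lemma qD_X_power: "qD (fps_X ^ k) = of_nat k * fps_X ^ k"
  by (rule fps_ext) (simp add: qD_nth fps_X_power_nth flip: fps_of_nat)

lemmas qD_simps = qD_add qD_diff qD_mult qD_power qD_1 qD_numeral

subsection \<open>Convolutions of Lambert series\<close>

definition geom :: "nat \<Rightarrow> 'a::comm_ring_1 fps"
  where "geom m = Abs_fps (\<lambda>n. of_bool (0 < n \<and> m dvd n))"

lemma geom_nth: "fps_nth (geom m) n = of_bool (0 < n \<and> m dvd n)"
  by (simp add: geom_def)

lemma geom_eq:
  assumes "m > 0"
  shows "geom m * (1 - fps_X ^ m) = fps_X ^ m"
proof (rule fps_ext)
  fix n
  have "fps_nth (geom m * (1 - fps_X ^ m)) n =
    fps_nth (geom m :: 'a fps) n - (if n < m then 0 else fps_nth (geom m) (n - m))"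
    by (simp add: right_diff_distrib fps_X_power_mult_right_nth)
  also have "\<dots> = of_bool (n = m)"
    using assms by (auto simp: geom_nth of_bool_def dvd_minus_self dest: dvd_imp_le)
  finally show "fps_nth (geom m * (1 - fps_X ^ m)) n = fps_nth (fps_X ^ m :: 'a fps) n"
    by (simp add: fps_X_power_nth of_bool_def)
qed

lemma one_minus_X_power_nonzero:
  assumes "m > 0"
  shows "(1 - fps_X ^ m :: 'a::comm_ring_1 fps) \<noteq> 0"
proof
  assume "(1 - fps_X ^ m :: 'a fps) = 0"
  moreover have "fps_nth (1 - fps_X ^ m :: 'a fps) 0 = 1"
    using assms by (simp add: fps_X_power_nth)
  ultimately show False by (simp only: fps_zero_nth zero_neq_one)
qed

text \<open>With \<open>x = q^m\<close> and \<open>y = q^k\<close> this is an identity of rational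
  functions in \<open>x\<close> and \<open>y\<close>. The denominators are nonzero, so it may be
  checked after multiplying by their product and cancelling.\<close>

lemma geom_mult:
  assumes "m > 0" "k > 0"
  shows "(geom m * geom k :: real fps) = geom (m + k) * (1 + geom m + geom k)"
proof -
  define x y :: "real fps" where "x = fps_X ^ m" and "y = fps_X ^ k"
  define u v w :: "real fps" where "u = geom m" and "v = geom k" and "w = geom (m + k)"
  have u: "u * (1 - x) = x" and v: "v * (1 - y) = y" and w: "w * (1 - x * y) = x * y"
    using geom_eq[of m] geom_eq[of k] geom_eq[of "m + k"] assms
    by (simp_all add: u_def v_def w_def x_def y_def power_add)
  have nz: "(1 - x) * (1 - y) * (1 - x * y) \<noteq> 0"
    using one_minus_X_power_nonzero[of m, where 'a = real]
      one_minus_X_power_nonzero[of k, where 'a = real]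
      one_minus_X_power_nonzero[of "m + k", where 'a = real] assms
    by (simp add: x_def y_def power_add)
  have "(u * v) * ((1 - x) * (1 - y) * (1 - x * y)) =
      (u * (1 - x)) * (v * (1 - y)) * (1 - x * y)"
    by (simp only: mult_ac)
  also have "\<dots> = x * y * ((1 - x) * (1 - y) + x * (1 - y) + (1 - x) * y)"
    by (simp only: u v) (simp add: algebra_simps)
  also have "\<dots> = (w * (1 - x * y)) *
      ((1 - x) * (1 - y) + (u * (1 - x)) * (1 - y) + (1 - x) * (v * (1 - y)))"
    by (simp only: u v w)
  also have "\<dots> = (w * (1 + u + v)) * ((1 - x) * (1 - y) * (1 - x * y))"
    by (simp add: algebra_simps)
  finally have "u * v = w * (1 + u + v)"
    using nz by simp
  thus ?thesis by (simp add: u_def v_def w_def)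
qed

lemma geom_mult_nth:
  assumes "m > 0" "k > 0"
  shows "fps_nth (geom m * geom k :: real fps) n = fps_nth (geom (m + k)) n
    + fps_nth (geom (m + k) * geom m) n + fps_nth (geom (m + k) * geom k) n"
  by (subst geom_mult[OF assms]) (simp add: distrib_left)

text \<open>The logarithmic derivative of \<open>1 - q^k\<close>, without division; it serves both
  to differentiate \<open>geom k\<close> and to differentiate the product defining tau.\<close>

lemma qD_one_minus_X_power:
  assumes "k > 0"
  shows "qD (1 - fps_X ^ k) = - of_nat k * geom k * (1 - fps_X ^ k :: 'a::comm_ring_1 fps)"
  using geom_eq[OF assms, where 'a = 'a]
  by (simp add: qD_diff qD_1 qD_X_power mult.assoc)

lemma qD_geom:
  assumes "m > 0"
  shows "qD (geom m :: real fps) = of_nat m * (geom m + geom m * geom m)"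
proof -
  define x where "x = (1 - fps_X ^ m :: real fps)"
  have nz: "x \<noteq> 0" using one_minus_X_power_nonzero[OF assms] by (simp add: x_def)
  have u: "geom m * x = 1 - x" using geom_eq[OF assms] by (simp add: x_def)
  have Dx: "qD x = - of_nat m * geom m * x"
    using qD_one_minus_X_power[OF assms, where 'a = real] by (simp add: x_def)
  have "qD (geom m * x) = qD (1 - x)" by (simp only: u)
  hence "qD (geom m) * x + geom m * qD x = - qD x"
    by (simp add: qD_simps)
  hence "qD (geom m) * x = (of_nat m * (geom m + geom m * geom m)) * x"
    unfolding Dx by (simp add: algebra_simps eq_neg_iff_add_eq_0)
  thus ?thesis using nz by simp
qed

text \<open>Reads the square off from \<open>qD_geom\<close>. This evaluates the diagonal terms of
  the convolutions, and its factor \<open>n\<close> becomes the \<open>qD\<close> terms in the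
  identities for \<open>sigma_fps\<close>.\<close>

lemma geom_square_nth:
  assumes "m > 0"
  shows "real m * fps_nth (geom m * geom m) n = (real n - real m) * fps_nth (geom m) n"
proof -
  have "fps_nth (qD (geom m :: real fps)) n = fps_nth (of_nat m * (geom m + geom m * geom m)) n"
    by (simp only: qD_geom[OF assms])
  hence "real n * fps_nth (geom m) n = real m * (fps_nth (geom m) n + fps_nth (geom m * geom m) n)"
    by (simp add: qD_nth flip: fps_of_nat)
  thus ?thesis by (simp add: algebra_simps)
qed

text \<open>Since \<open>geom c = q^c (1 + geom c)\<close>, the product is divisible by
  \<open>q^(a + b)\<close>.\<close>

lemma geom_mult_nth_eq_0:
  assumes "a > 0" "b > 0" "n < a + b"
  shows "fps_nth (geom a * geom b :: real fps) n = 0"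
proof -
  have *: "geom c = fps_X ^ c * (1 + geom c :: real fps)" if "c > 0" for c
    using geom_eq[OF that, where 'a = real] by (simp add: algebra_simps)
  have "geom a * geom b = fps_X ^ (a + b) * ((1 + geom a) * (1 + geom b) :: real fps)"
    by (subst *[OF assms(1)], subst *[OF assms(2)]) (simp only: power_add mult_ac)
  thus ?thesis using assms(3) by (simp only: fps_X_power_mult_nth if_True)
qed

lemma geom_nth_eq_0: "n < a \<Longrightarrow> fps_nth (geom a) n = 0"
  by (auto simp: geom_nth dest: dvd_imp_le)

text \<open>The formal sum of \<open>c m * geom m\<close> over all positive \<open>m\<close>.
  Cutting it off at \<open>m = n\<close> loses nothing in degree \<open>n\<close>, because
  \<open>geom m\<close> starts with \<open>q^m\<close>.\<close>

definition lambert :: "(nat \<Rightarrow> 'a::comm_ring_1) \<Rightarrow> 'a fps"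
  where "lambert c = Abs_fps (\<lambda>n. \<Sum>m=1..n. c m * fps_nth (geom m) n)"

text \<open>One cut-off \<open>N\<close> serves all degrees up to \<open>N\<close>, so that the
  factors of a product, or a finite Euler product, can share an index range.\<close>

lemma lambert_nth:
  assumes "n \<le> N"
  shows "fps_nth (lambert c) n = (\<Sum>m=1..N. c m * fps_nth (geom m) n)"
  unfolding lambert_def fps_nth_Abs_fps
  by (rule sum.mono_neutral_left) (use assms in \<open>auto simp: geom_nth_eq_0\<close>)

lemma lambert_nth_divisors:
  assumes "n > 0"
  shows "fps_nth (lambert c) n = (\<Sum>d | d dvd n \<and> d > 0. c d)"
proof -
  have "fps_nth (lambert c) n = (\<Sum>m=1..n. if m dvd n then c m else 0)"
    unfolding lambert_def fps_nth_Abs_fps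
    by (rule sum.cong) (use assms in \<open>auto simp: geom_nth\<close>)
  also have "\<dots> = (\<Sum>m | m \<in> {1..n} \<and> m dvd n. c m)"
    by (subst sum.inter_filter) simp_all
  also have "{m. m \<in> {1..n} \<and> m dvd n} = {d. d dvd n \<and> d > 0}"
    using assms by (auto dest: dvd_imp_le)
  finally show ?thesis .
qed

lemma lambert_mult_nth:
  "fps_nth (lambert c * lambert d) n =
    (\<Sum>a=1..n. \<Sum>b=1..n. c a * d b * fps_nth (geom a * geom b) n)"
proof -
  have "fps_nth (lambert c * lambert d) n =
      (\<Sum>i=0..n. (\<Sum>a=1..n. c a * fps_nth (geom a) i) * (\<Sum>b=1..n. d b * fps_nth (geom b) (n - i)))"
    unfolding fps_mult_nth by (intro sum.cong refl) (simp add: lambert_nth[of _ n])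
  also have "\<dots> = (\<Sum>i=0..n. \<Sum>a=1..n. \<Sum>b=1..n.
      c a * d b * (fps_nth (geom a) i * fps_nth (geom b) (n - i)))"
    by (simp add: sum_product mult_ac)
  also have "\<dots> = (\<Sum>a=1..n. \<Sum>i=0..n. \<Sum>b=1..n.
      c a * d b * (fps_nth (geom a) i * fps_nth (geom b) (n - i)))"
    by (rule sum.swap)
  also have "\<dots> = (\<Sum>a=1..n. \<Sum>b=1..n. \<Sum>i=0..n.
      c a * d b * (fps_nth (geom a) i * fps_nth (geom b) (n - i)))"
    by (intro sum.cong refl sum.swap)
  finally show ?thesis
    by (simp add: fps_mult_nth sum_distrib_left)
qed

lemma sum_square_split:
  fixes G :: "nat \<Rightarrow> nat \<Rightarrow> real"
  shows "(\<Sum>c=1..n. \<Sum>b=1..n. G c b) = (\<Sum>b=1..n. G b b)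
    + (\<Sum>b=1..n. \<Sum>c=b+1..n. G c b) + (\<Sum>b=1..n. \<Sum>c=b+1..n. G b c)"
proof (induction n)
  case (Suc n)
  have *: "(\<Sum>b=1..Suc n. \<Sum>c=b+1..Suc n. H b c) =
      (\<Sum>b=1..n. \<Sum>c=b+1..n. H b c) + (\<Sum>b=1..n. H b (Suc n))" for H :: "nat \<Rightarrow> nat \<Rightarrow> real"
    by (simp add: sum.distrib)
  show ?case unfolding * using Suc by (simp add: sum.distrib)
qed simp

text \<open>The symmetry conditions say that \<open>F\<close> is a function of the triple
  \<open>(a, b, - a - b)\<close> invariant under permutations and the global sign; these are the
  forms on which the three-term relation for \<open>g\<close> closes up.\<close>

lemma three_term_convolution:
  fixes g :: "nat \<Rightarrow> nat \<Rightarrow> real"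
    and h :: "nat \<Rightarrow> real"
    and F :: "real \<Rightarrow> real \<Rightarrow> real"
  assumes g_sym: "\<And>a b. g a b = g b a"
    and g_0: "\<And>a b. a > 0 \<Longrightarrow> b > 0 \<Longrightarrow> n < a + b \<Longrightarrow> g a b = 0"
    and h_0: "\<And>a. n < a \<Longrightarrow> h a = 0"
    and rel: "\<And>a b. a > 0 \<Longrightarrow> b > 0 \<Longrightarrow> g a b = h (a + b) + g (a + b) a + g (a + b) b"
    and F_sym: "\<And>a b. F a b = F b a"
    and F_shift: "\<And>a b. F (a - b) b = F a (- b)"
    and F_neg: "\<And>a b. F a (- b) = F b (- a)"
  shows "(\<Sum>a=1..n. \<Sum>b=1..n. (F a b - F a (- real b)) * g a b) =
    (\<Sum>m=1..n. h m * (\<Sum>a\<in>{1..<m}. F a (real m - real a))) - (\<Sum>a=1..n. F a (- real a) * g a a)"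
proof -
  \<comment> \<open>\<open>T\<close> collects the off-diagonal products. The two mixed terms of
    \<open>rel\<close> contribute it once each and the sign-reversed sum contributes it twice, so it
    cancels in the difference.\<close>
  define T where "T = (\<Sum>b=1..n. \<Sum>c=b+1..n. F c (- real b) * g c b)"
  have T: "(\<Sum>b=1..n. \<Sum>a=1..n. F a b * g (a + b) b) = T"
    unfolding T_def
  proof (rule sum.cong[OF refl])
    fix b assume b: "b \<in> {1..n}"
    \<comment> \<open>Substitute \<open>c = a + b\<close>; the terms with \<open>c > n\<close>
      vanish by \<open>g_0\<close>.\<close>
    have "(\<Sum>a=1..n. F a b * g (a + b) b) = (\<Sum>c=1+b..n+b. F (c - b) b * g c b)"
      unfolding sum.shift_bounds_cl_nat_ivl
      by (rule sum.cong) auto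
    also have "\<dots> = (\<Sum>c=b+1..n. F (c - b) b * g c b)"
      by (rule sum.mono_neutral_right) (use b g_0 in auto)
    finally show "(\<Sum>a=1..n. F a b * g (a + b) b) = (\<Sum>c=b+1..n. F c (- real b) * g c b)"
      by (simp add: F_shift)
  qed
  have T': "(\<Sum>a=1..n. \<Sum>b=1..n. F a b * g (a + b) b) = T"
    unfolding T[symmetric] by (rule sum.swap)
  have T'': "(\<Sum>a=1..n. \<Sum>b=1..n. F a b * g (a + b) a) = T"
    unfolding T[symmetric] by (intro sum.cong refl) (simp add: F_sym add.commute)
  have "(\<Sum>c=1..n. \<Sum>b=1..n. F c (- real b) * g c b) = (\<Sum>b=1..n. F b (- real b) * g b b) + T +
      (\<Sum>b=1..n. \<Sum>c=b+1..n. F b (- real c) * g b c)"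
    unfolding T_def by (rule sum_square_split)
  also have "(\<Sum>b=1..n. \<Sum>c=b+1..n. F b (- real c) * g b c) = T"
    unfolding T_def by (intro sum.cong refl) (metis F_neg g_sym)
  finally have neg: "(\<Sum>c=1..n. \<Sum>b=1..n. F c (- real b) * g c b) =
      (\<Sum>b=1..n. F b (- real b) * g b b) + 2 * T" by simp
  have "(\<Sum>a=1..n. \<Sum>b=1..n. F a b * h (a + b)) = (\<Sum>a=1..n. \<Sum>m=a+1..n. F a (real m - real a) * h m)"
  proof (rule sum.cong[OF refl])
    fix a assume a: "a \<in> {1..n}"
    have "(\<Sum>b=1..n. F a b * h (a + b)) = (\<Sum>m=1+a..n+a. F a (real m - real a) * h m)"
      unfolding sum.shift_bounds_cl_nat_ivl by (rule sum.cong) (auto simp: add.commute)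
    also have "\<dots> = (\<Sum>m=a+1..n. F a (real m - real a) * h m)"
      by (rule sum.mono_neutral_right) (use a h_0 in auto)
    finally show "(\<Sum>b=1..n. F a b * h (a + b)) = (\<Sum>m=a+1..n. F a (real m - real a) * h m)" .
  qed
  also have "\<dots> = (\<Sum>m=1..n. \<Sum>a\<in>{1..<m}. F a (real m - real a) * h m)"
    by (simp add: sum.Sigma, rule sum.reindex_bij_witness[of _ "\<lambda>(x, y). (y, x)" "\<lambda>(x, y). (y, x)"])
      auto
  finally have H: "(\<Sum>a=1..n. \<Sum>b=1..n. F a b * h (a + b)) =
      (\<Sum>m=1..n. h m * (\<Sum>a\<in>{1..<m}. F a (real m - real a)))"
    by (simp add: sum_distrib_left mult_ac)
  have "(\<Sum>a=1..n. \<Sum>b=1..n. F a b * g a b) =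
      (\<Sum>a=1..n. \<Sum>b=1..n. F a b * h (a + b) + F a b * g (a + b) a + F a b * g (a + b) b)"
    by (intro sum.cong refl, subst rel) (auto simp: distrib_left)
  also have "\<dots> = (\<Sum>m=1..n. h m * (\<Sum>a\<in>{1..<m}. F a (real m - real a))) + 2 * T"
    unfolding sum.distrib T' T'' H by simp
  finally show ?thesis
    using neg by (simp add: left_diff_distrib sum_subtractf)
qed

lemma sum_lessThan_powers:
  "(\<Sum>a<m. real a) = real m ^ 2 / 2 - real m / 2"
  "(\<Sum>a<m. real a ^ 2) = real m ^ 3 / 3 - real m ^ 2 / 2 + real m / 6"
  "(\<Sum>a<m. real a ^ 3) = real m ^ 4 / 4 - real m ^ 3 / 2 + real m ^ 2 / 4"
  "(\<Sum>a<m. real a ^ 4) = real m ^ 5 / 5 - real m ^ 4 / 2 + real m ^ 3 / 3 - real m / 30"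
  "(\<Sum>a<m. real a ^ 5) = real m ^ 6 / 6 - real m ^ 5 / 2 + 5 * real m ^ 4 / 12 - real m ^ 2 / 12"
  "(\<Sum>a<m. real a ^ 6) = real m ^ 7 / 7 - real m ^ 6 / 2 + real m ^ 5 / 2 - real m ^ 3 / 6
    + real m / 42"
  "(\<Sum>a<m. real a ^ 7) = real m ^ 8 / 8 - real m ^ 7 / 2 + 7 * real m ^ 6 / 12
    - 7 * real m ^ 4 / 24 + real m ^ 2 / 12"
  "(\<Sum>a<m. real a ^ 8) = real m ^ 9 / 9 - real m ^ 8 / 2 + 2 * real m ^ 7 / 3
    - 7 * real m ^ 5 / 15 + 2 * real m ^ 3 / 9 - real m / 30"
  subgoal by (induction m) (simp_all add: field_simps eval_nat_numeral)
  subgoal by (induction m) (simp_all add: field_simps eval_nat_numeral)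
  subgoal by (induction m) (simp_all add: field_simps eval_nat_numeral)
  subgoal by (induction m) (simp_all add: field_simps eval_nat_numeral)
  subgoal by (induction m) (simp_all add: field_simps eval_nat_numeral)
  subgoal by (induction m) (simp_all add: field_simps eval_nat_numeral)
  subgoal by (induction m) (simp_all add: field_simps eval_nat_numeral)
  subgoal by (induction m) (simp_all add: field_simps eval_nat_numeral)
  done

lemma fps_nth_numeral_mult:
  "fps_nth (numeral k * f :: 'a::comm_ring_1 fps) n = numeral k * fps_nth f n"
  by (simp add: numeral_fps_const)

text \<open>The function \<open>q\<close> describes the diagonal: the factor \<open>a\<close> in
  \<open>F_diag\<close> is the one that \<open>geom_square_nth\<close> needs. In
  \<open>F_sum\<close> the term \<open>F 0 m\<close> accounts for \<open>a = 0\<close>, so for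
  positive \<open>m\<close> the value \<open>p m\<close> is the sum over
  \<open>0 < a < m\<close>.\<close>

lemma geom_convolution:
  fixes F :: "real \<Rightarrow> real \<Rightarrow> real"
  assumes F_sym: "\<And>a b. F a b = F b a"
    and F_shift: "\<And>a b. F (a - b) b = F a (- b)"
    and F_neg: "\<And>a b. F a (- b) = F b (- a)"
    and F_diag: "\<And>a. F a (- a) = a * q a"
    and F_sum: "\<And>m. (\<Sum>a<m. F (real a) (real m - real a)) = F 0 m + p (real m)"
  shows "(\<Sum>a=1..n. \<Sum>b=1..n. (F a b - F a (- real b)) * fps_nth (geom a * geom b) n) =
    (\<Sum>m=1..n. (p m - (real n - real m) * q m) * fps_nth (geom m) n)"
proof -
  have "(\<Sum>a=1..n. \<Sum>b=1..n. (F a b - F a (- real b)) * fps_nth (geom a * geom b) n) =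
      (\<Sum>m=1..n. fps_nth (geom m) n * (\<Sum>a\<in>{1..<m}. F a (real m - real a)))
      - (\<Sum>a=1..n. F a (- real a) * fps_nth (geom a * geom a) n)"
  proof (rule three_term_convolution)
    show "F a b = F b a" "F (a - b) b = F a (- b)" "F a (- b) = F b (- a)" for a b
      by (fact F_sym F_shift F_neg)+
    show "fps_nth (geom a * geom b) n = fps_nth (geom b * geom a :: real fps) n" for a b
      by (simp only: mult.commute)
  qed (blast intro: geom_mult_nth_eq_0 geom_nth_eq_0 geom_mult_nth)+
  also have "(\<Sum>m=1..n. fps_nth (geom m) n * (\<Sum>a\<in>{1..<m}. F a (real m - real a))) =
      (\<Sum>m=1..n. p m * fps_nth (geom m) n)"
  proof (rule sum.cong[OF refl])
    fix m assume m: "m \<in> {1..n}"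
    have "(\<Sum>a<m. F (real a) (real m - real a)) = F 0 m + (\<Sum>a\<in>{1..<m}. F a (real m - real a))"
      using m sum.atLeast_Suc_lessThan[of 0 m "\<lambda>a. F a (real m - real a)"]
      by (simp add: lessThan_atLeast0)
    thus "fps_nth (geom m) n * (\<Sum>a\<in>{1..<m}. F a (real m - real a)) = p m * fps_nth (geom m) n"
      by (simp add: F_sum)
  qed
  also have "(\<Sum>a=1..n. F a (- real a) * fps_nth (geom a * geom a) n) =
      (\<Sum>a=1..n. (real n - real a) * q a * fps_nth (geom a) n)"
  proof (rule sum.cong[OF refl])
    fix a assume a: "a \<in> {1..n}"
    have "F a (- real a) * fps_nth (geom a * geom a) n
      = q a * (real a * fps_nth (geom a * geom a) n)"
      by (simp add: F_diag)
    also have "\<dots> = q a * ((real n - real a) * fps_nth (geom a) n)"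
      using a by (subst geom_square_nth) auto
    finally show "F a (- real a) * fps_nth (geom a * geom a) n
      = (real n - real a) * q a * fps_nth (geom a) n"
      by simp
  qed
  finally show ?thesis
    by (simp add: left_diff_distrib sum_subtractf)
qed

subsection \<open>Ramanujan's differential equations\<close>

definition sigma_fps :: "nat \<Rightarrow> real fps"
  where "sigma_fps k = lambert (\<lambda>d. real d ^ k)"

lemma sigma_fps_nth: "fps_nth (sigma_fps k) n = (\<Sum>m=1..n. real m ^ k * fps_nth (geom m) n)"
  unfolding sigma_fps_def by (rule lambert_nth) simp

lemma sigma_fps_mult_nth:
  "fps_nth (sigma_fps j * sigma_fps k) n
    = (\<Sum>a=1..n. \<Sum>b=1..n. real a ^ j * real b ^ k * fps_nth (geom a * geom b) n)"
  unfolding sigma_fps_def by (rule lambert_mult_nth)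

text \<open>The form \<open>s\<close>. The difference \<open>F a b - F a (- b)\<close> doubles the
  part odd in \<open>b\<close>, which yields the product of divisor series. The even power in
  \<open>p\<close> cancels against the diagonal, whose factor \<open>n\<close> gives the
  derivative.\<close>

lemma sigma_fps_1_1:
  "12 * (sigma_fps 1 * sigma_fps 1) = sigma_fps 1 + 5 * sigma_fps 3 - 6 * qD (sigma_fps 1)"
proof (rule fps_ext)
  fix n
  define F where "F a b = a ^ 2 + a * b + b ^ 2" for a b :: real
  define p where "p x = x / 6 - x ^ 2 + 5 / 6 * x ^ 3" for x :: real
  have F_odd: "F a b - F a (- b) = 2 * (a * b)" for a b
    by (simp add: F_def algebra_simps eval_nat_numeral)
  have "(\<Sum>a=1..n. \<Sum>b=1..n. (F a b - F a (- real b)) * fps_nth (geom a * geom b) n) =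
      (\<Sum>m=1..n. (p m - (real n - real m) * real m) * fps_nth (geom m) n)"
  proof (rule geom_convolution)
    fix m :: nat
    have "(\<Sum>a<m. F (real a) (real m - real a))
      = real m ^ 2 * real m - real m * (\<Sum>a<m. real a) + (\<Sum>a<m. real a ^ 2)"
      by (simp add: F_def sum.distrib sum_subtractf sum_distrib_left algebra_simps eval_nat_numeral)
    also have "\<dots> = F 0 m + p m"
      unfolding F_def p_def sum_lessThan_powers by (simp add: field_simps eval_nat_numeral)
    finally show "(\<Sum>a<m. F (real a) (real m - real a)) = F 0 m + p m" .
  qed (simp_all add: F_def algebra_simps eval_nat_numeral)
  also have "(\<Sum>a=1..n. \<Sum>b=1..n. (F a b - F a (- real b)) * fps_nth (geom a * geom b) n) =
      2 * fps_nth (sigma_fps 1 * sigma_fps 1) n"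
    unfolding F_odd sigma_fps_mult_nth sum_distrib_left sum.distrib [symmetric]
    by (intro sum.cong refl) (simp add: algebra_simps)
  also have "(\<Sum>m=1..n. (p m - (real n - real m) * real m) * fps_nth (geom m) n) =
      1 / 6 * fps_nth (sigma_fps 1) n + 5 / 6 * fps_nth (sigma_fps 3) n - real n
        * fps_nth (sigma_fps 1) n"
    unfolding p_def sigma_fps_nth sum_distrib_left sum.distrib [symmetric] sum_subtractf [symmetric]
    by (intro sum.cong refl) (simp add: field_simps eval_nat_numeral)
  finally show "fps_nth (12 * (sigma_fps 1 * sigma_fps 1)) n =
      fps_nth (sigma_fps 1 + 5 * sigma_fps 3 - 6 * qD (sigma_fps 1)) n"
    unfolding fps_add_nth fps_sub_nth fps_nth_numeral_mult qD_nth
    by (simp add: mult.commute[of "sigma_fps _" "sigma_fps _"] field_simps)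
qed

text \<open>The form \<open>s^2\<close>, in weight six; it becomes the differential equation for
  \<open>E4\<close>.\<close>

lemma sigma_fps_1_3:
  "240 * (sigma_fps 1 * sigma_fps 3)
    = 21 * sigma_fps 5 + 10 * sigma_fps 3 - sigma_fps 1 - 30 * qD (sigma_fps 3)"
proof (rule fps_ext)
  fix n
  define F where "F a b = (a ^ 2 + a * b + b ^ 2) ^ 2" for a b :: real
  define p where "p x = x ^ 3 / 3 - x / 30 - x ^ 4 + 7 / 10 * x ^ 5" for x :: real
  have F_odd: "F a b - F a (- b) = 4 * (a * b ^ 3) + 4 * (a ^ 3 * b)" for a b
    by (simp add: F_def algebra_simps eval_nat_numeral)
  have "(\<Sum>a=1..n. \<Sum>b=1..n. (F a b - F a (- real b)) * fps_nth (geom a * geom b) n) =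
      (\<Sum>m=1..n. (p m - (real n - real m) * real m ^ 3) * fps_nth (geom m) n)"
  proof (rule geom_convolution)
    fix m :: nat
    have "(\<Sum>a<m. F (real a) (real m - real a))
      = real m ^ 4 * real m - 2 * real m ^ 3 * (\<Sum>a<m. real a) + 3 * real m ^ 2 * (\<Sum>a<m. real a ^ 2)
        - 2 * real m * (\<Sum>a<m. real a ^ 3) + (\<Sum>a<m. real a ^ 4)"
      by (simp add: F_def sum.distrib sum_subtractf sum_distrib_left algebra_simps eval_nat_numeral)
    also have "\<dots> = F 0 m + p m"
      unfolding F_def p_def sum_lessThan_powers by (simp add: field_simps eval_nat_numeral)
    finally show "(\<Sum>a<m. F (real a) (real m - real a)) = F 0 m + p m" .
  qed (simp_all add: F_def algebra_simps eval_nat_numeral)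
  also have "(\<Sum>a=1..n. \<Sum>b=1..n. (F a b - F a (- real b)) * fps_nth (geom a * geom b) n) =
      4 * fps_nth (sigma_fps 1 * sigma_fps 3) n + 4 * fps_nth (sigma_fps 3 * sigma_fps 1) n"
    unfolding F_odd sigma_fps_mult_nth sum_distrib_left sum.distrib [symmetric]
    by (intro sum.cong refl) (simp add: algebra_simps)
  also have "(\<Sum>m=1..n. (p m - (real n - real m) * real m ^ 3) * fps_nth (geom m) n) =
      1 / 3 * fps_nth (sigma_fps 3) n - 1 / 30 * fps_nth (sigma_fps 1) n + 7 / 10
        * fps_nth (sigma_fps 5) n - real n * fps_nth (sigma_fps 3) n"
    unfolding p_def sigma_fps_nth sum_distrib_left sum.distrib [symmetric] sum_subtractf [symmetric]
    by (intro sum.cong refl) (simp add: field_simps eval_nat_numeral)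
  finally show "fps_nth (240 * (sigma_fps 1 * sigma_fps 3)) n =
      fps_nth (21 * sigma_fps 5 + 10 * sigma_fps 3 - sigma_fps 1 - 30 * qD (sigma_fps 3)) n"
    unfolding fps_add_nth fps_sub_nth fps_nth_numeral_mult qD_nth
    by (simp add: mult.commute[of "sigma_fps _" "sigma_fps _"] field_simps)
qed

text \<open>The form \<open>p^2\<close> vanishes at \<open>b = - a\<close>, so there is no
  derivative term.\<close>

lemma sigma_fps_3_3:
  "120 * (sigma_fps 3 * sigma_fps 3) = sigma_fps 7 - sigma_fps 3"
proof (rule fps_ext)
  fix n
  define F where "F a b = (a * b * (a + b)) ^ 2" for a b :: real
  define p where "p x = x ^ 7 / 30 - x ^ 3 / 30" for x :: real
  have F_odd: "F a b - F a (- b) = 4 * (a ^ 3 * b ^ 3)" for a b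
    by (simp add: F_def algebra_simps eval_nat_numeral)
  have "(\<Sum>a=1..n. \<Sum>b=1..n. (F a b - F a (- real b)) * fps_nth (geom a * geom b) n) =
      (\<Sum>m=1..n. (p m - (real n - real m) * 0) * fps_nth (geom m) n)"
  proof (rule geom_convolution)
    fix m :: nat
    have "(\<Sum>a<m. F (real a) (real m - real a))
      = real m ^ 4 * (\<Sum>a<m. real a ^ 2) - 2 * real m ^ 3 * (\<Sum>a<m. real a ^ 3) + real m ^ 2
        * (\<Sum>a<m. real a ^ 4)"
      by (simp add: F_def sum.distrib sum_subtractf sum_distrib_left algebra_simps eval_nat_numeral)
    also have "\<dots> = F 0 m + p m"
      unfolding F_def p_def sum_lessThan_powers by (simp add: field_simps eval_nat_numeral)
    finally show "(\<Sum>a<m. F (real a) (real m - real a)) = F 0 m + p m" .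
  qed (simp_all add: F_def algebra_simps eval_nat_numeral)
  also have "(\<Sum>a=1..n. \<Sum>b=1..n. (F a b - F a (- real b)) * fps_nth (geom a * geom b) n) =
      4 * fps_nth (sigma_fps 3 * sigma_fps 3) n"
    unfolding F_odd sigma_fps_mult_nth sum_distrib_left sum.distrib [symmetric]
    by (intro sum.cong refl) (simp add: algebra_simps)
  also have "(\<Sum>m=1..n. (p m - (real n - real m) * 0) * fps_nth (geom m) n) =
      1 / 30 * fps_nth (sigma_fps 7) n - 1 / 30 * fps_nth (sigma_fps 3) n"
    unfolding p_def sigma_fps_nth sum_distrib_left sum.distrib [symmetric] sum_subtractf [symmetric]
    by (intro sum.cong refl) (simp add: field_simps eval_nat_numeral)
  finally show "fps_nth (120 * (sigma_fps 3 * sigma_fps 3)) n =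
      fps_nth (sigma_fps 7 - sigma_fps 3) n"
    unfolding fps_add_nth fps_sub_nth fps_nth_numeral_mult qD_nth
    by (simp add: mult.commute[of "sigma_fps _" "sigma_fps _"] field_simps)
qed

text \<open>The form \<open>s^3\<close> mixes two products of weight eight;
  \<open>sigma_fps_3_3\<close> later removes the second one and leaves the equation for
  \<open>E6\<close>.\<close>

lemma sigma_fps_1_5_3_3:
  "5040 * (sigma_fps 1 * sigma_fps 5) + 5880 * (sigma_fps 3 * sigma_fps 3)
    = 10 * sigma_fps 1 - 49 * sigma_fps 3 + 210 * sigma_fps 5 + 249 * sigma_fps 7 - 420
      * qD (sigma_fps 5)"
proof (rule fps_ext)
  fix n
  define F where "F a b = (a ^ 2 + a * b + b ^ 2) ^ 3" for a b :: real
  define p where "p x = x / 42 - 7 / 60 * x ^ 3 + x ^ 5 / 2 - x ^ 6 + 83 / 140 * x ^ 7"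
    for x :: real
  have F_odd: "F a b - F a (- b) = 6 * (a * b ^ 5) + 14 * (a ^ 3 * b ^ 3) + 6 * (a ^ 5 * b)" for a b
    by (simp add: F_def algebra_simps eval_nat_numeral)
  have "(\<Sum>a=1..n. \<Sum>b=1..n. (F a b - F a (- real b)) * fps_nth (geom a * geom b) n) =
      (\<Sum>m=1..n. (p m - (real n - real m) * real m ^ 5) * fps_nth (geom m) n)"
  proof (rule geom_convolution)
    fix m :: nat
    have "(\<Sum>a<m. F (real a) (real m - real a))
      = real m ^ 6 * real m - 3 * real m ^ 5 * (\<Sum>a<m. real a) + 6 * real m ^ 4 * (\<Sum>a<m. real a ^ 2)
        - 7 * real m ^ 3 * (\<Sum>a<m. real a ^ 3) + 6 * real m ^ 2 * (\<Sum>a<m. real a ^ 4) - 3 * real m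
          * (\<Sum>a<m. real a ^ 5) + (\<Sum>a<m. real a ^ 6)"
      by (simp add: F_def sum.distrib sum_subtractf sum_distrib_left algebra_simps eval_nat_numeral)
    also have "\<dots> = F 0 m + p m"
      unfolding F_def p_def sum_lessThan_powers by (simp add: field_simps eval_nat_numeral)
    finally show "(\<Sum>a<m. F (real a) (real m - real a)) = F 0 m + p m" .
  qed (simp_all add: F_def algebra_simps eval_nat_numeral)
  also have "(\<Sum>a=1..n. \<Sum>b=1..n. (F a b - F a (- real b)) * fps_nth (geom a * geom b) n) =
      6 * fps_nth (sigma_fps 1 * sigma_fps 5) n + 14 * fps_nth (sigma_fps 3 * sigma_fps 3) n + 6
        * fps_nth (sigma_fps 5 * sigma_fps 1) n"
    unfolding F_odd sigma_fps_mult_nth sum_distrib_left sum.distrib [symmetric]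
    by (intro sum.cong refl) (simp add: algebra_simps)
  also have "(\<Sum>m=1..n. (p m - (real n - real m) * real m ^ 5) * fps_nth (geom m) n) =
      1 / 42 * fps_nth (sigma_fps 1) n - 7 / 60 * fps_nth (sigma_fps 3) n + 1 / 2
        * fps_nth (sigma_fps 5) n + 83 / 140 * fps_nth (sigma_fps 7) n - real n
          * fps_nth (sigma_fps 5) n"
    unfolding p_def sigma_fps_nth sum_distrib_left sum.distrib [symmetric] sum_subtractf [symmetric]
    by (intro sum.cong refl) (simp add: field_simps eval_nat_numeral)
  finally show "fps_nth (5040 * (sigma_fps 1 * sigma_fps 5) + 5880
    * (sigma_fps 3 * sigma_fps 3)) n =
      fps_nth (10 * sigma_fps 1 - 49 * sigma_fps 3 + 210 * sigma_fps 5 + 249 * sigma_fps 7 - 420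
        * qD (sigma_fps 5)) n"
    unfolding fps_add_nth fps_sub_nth fps_nth_numeral_mult qD_nth
    by (simp add: mult.commute[of "sigma_fps _" "sigma_fps _"] field_simps)
qed

text \<open>The form \<open>s^2 p^2\<close>, in weight twelve, again with zero diagonal.\<close>

lemma sigma_fps_3_7_5_5:
  "10080 * (sigma_fps 3 * sigma_fps 7) + 12600 * (sigma_fps 5 * sigma_fps 5)
    = 50 * sigma_fps 5 - 21 * sigma_fps 3 - 42 * sigma_fps 7 + 13 * sigma_fps 11"
proof (rule fps_ext)
  fix n
  define F where "F a b = (a * b * (a + b) * (a ^ 2 + a * b + b ^ 2)) ^ 2" for a b :: real
  define p where "p x = 5 / 63 * x ^ 5 - x ^ 3 / 30 - x ^ 7 / 15 + 13 / 630 * x ^ 11" for x :: real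
  have F_odd: "F a b - F a (- b) = 8 * (a ^ 3 * b ^ 7) + 20 * (a ^ 5 * b ^ 5) + 8 * (a ^ 7 * b ^ 3)"
    for a b
    by (simp add: F_def algebra_simps eval_nat_numeral)
  have "(\<Sum>a=1..n. \<Sum>b=1..n. (F a b - F a (- real b)) * fps_nth (geom a * geom b) n) =
      (\<Sum>m=1..n. (p m - (real n - real m) * 0) * fps_nth (geom m) n)"
  proof (rule geom_convolution)
    fix m :: nat
    have "(\<Sum>a<m. F (real a) (real m - real a))
      = real m ^ 8 * (\<Sum>a<m. real a ^ 2) - 4 * real m ^ 7 * (\<Sum>a<m. real a ^ 3) + 8 * real m ^ 6
        * (\<Sum>a<m. real a ^ 4) - 10 * real m ^ 5 * (\<Sum>a<m. real a ^ 5) + 8 * real m ^ 4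
          * (\<Sum>a<m. real a ^ 6) - 4 * real m ^ 3 * (\<Sum>a<m. real a ^ 7) + real m ^ 2
            * (\<Sum>a<m. real a ^ 8)"
      by (simp add: F_def sum.distrib sum_subtractf sum_distrib_left algebra_simps eval_nat_numeral)
    also have "\<dots> = F 0 m + p m"
      unfolding F_def p_def sum_lessThan_powers by (simp add: field_simps eval_nat_numeral)
    finally show "(\<Sum>a<m. F (real a) (real m - real a)) = F 0 m + p m" .
  qed (simp_all add: F_def algebra_simps eval_nat_numeral)
  also have "(\<Sum>a=1..n. \<Sum>b=1..n. (F a b - F a (- real b)) * fps_nth (geom a * geom b) n) =
      8 * fps_nth (sigma_fps 3 * sigma_fps 7) n + 20 * fps_nth (sigma_fps 5 * sigma_fps 5) n + 8
        * fps_nth (sigma_fps 7 * sigma_fps 3) n"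
    unfolding F_odd sigma_fps_mult_nth sum_distrib_left sum.distrib [symmetric]
    by (intro sum.cong refl) (simp add: algebra_simps)
  also have "(\<Sum>m=1..n. (p m - (real n - real m) * 0) * fps_nth (geom m) n) =
      5 / 63 * fps_nth (sigma_fps 5) n - 1 / 30 * fps_nth (sigma_fps 3) n - 1 / 15
        * fps_nth (sigma_fps 7) n + 13 / 630 * fps_nth (sigma_fps 11) n"
    unfolding p_def sigma_fps_nth sum_distrib_left sum.distrib [symmetric] sum_subtractf [symmetric]
    by (intro sum.cong refl) (simp add: field_simps eval_nat_numeral)
  finally show "fps_nth (10080 * (sigma_fps 3 * sigma_fps 7) + 12600
    * (sigma_fps 5 * sigma_fps 5)) n =
      fps_nth (50 * sigma_fps 5 - 21 * sigma_fps 3 - 42 * sigma_fps 7 + 13 * sigma_fps 11) n"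
    unfolding fps_add_nth fps_sub_nth fps_nth_numeral_mult qD_nth
    by (simp add: mult.commute[of "sigma_fps _" "sigma_fps _"] field_simps)
qed

lemma sigma_fps_nth_0: "fps_nth (sigma_fps k) 0 = 0"
  by (simp add: sigma_fps_nth)

lemma sigma_fps_nth_1: "fps_nth (sigma_fps k) (Suc 0) = 1"
  by (simp add: sigma_fps_nth geom_nth)

lemma sigma_fps_nth_2: "fps_nth (sigma_fps k) 2 = 1 + 2 ^ k"
  by (simp add: sigma_fps_nth geom_nth numeral_2_eq_2)

definition E2 :: "real fps" where "E2 = 1 - 24 * sigma_fps 1"
definition E4 :: "real fps" where "E4 = 1 + 240 * sigma_fps 3"
definition E6 :: "real fps" where "E6 = 1 - 504 * sigma_fps 5"

lemma sigma_fps_7_eq: "480 * sigma_fps 7 = E4 ^ 2 - 1"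
  using sigma_fps_3_3 unfolding E4_def by algebra

text \<open>After \<open>E4 ^ 2\<close> is written as \<open>1 + 480 * sigma_fps 7\<close>, the
  weights 441 and 250 make the quadratic terms 5040 times the left side of
  \<open>sigma_fps_3_7_5_5\<close>.\<close>

lemma sigma_fps_11_eq: "65520 * sigma_fps 11 = 441 * E4 ^ 3 + 250 * E6 ^ 2 - 691"
  using sigma_fps_3_3 sigma_fps_3_7_5_5 unfolding E4_def E6_def by algebra

lemma qD_E2: "12 * qD E2 = E2 ^ 2 - E4"
  using sigma_fps_1_1 unfolding E2_def E4_def qD_simps by algebra

lemma qD_E4: "3 * qD E4 = E2 * E4 - E6"
  using sigma_fps_1_3 unfolding E2_def E4_def E6_def qD_simps by algebra

lemma qD_E6: "2 * qD E6 = E2 * E6 - E4 ^ 2"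
  using sigma_fps_1_5_3_3 sigma_fps_3_3 unfolding E2_def E4_def E6_def qD_simps by algebra

text \<open>By Ramanujan's equations the mixed terms \<open>E4 ^ 2 * E6\<close> cancel.\<close>

lemma qD_discriminant: "qD (E4 ^ 3 - E6 ^ 2) = (E4 ^ 3 - E6 ^ 2) * E2"
proof -
  have "qD (E4 ^ 3 - E6 ^ 2) = E4 ^ 2 * (3 * qD E4) - E6 * (2 * qD E6)"
    by (simp add: qD_simps algebra_simps)
  thus ?thesis unfolding qD_E4 qD_E6 by algebra
qed

text \<open>In degree \<open>n\<close> the equation expresses \<open>(n - 1) f_n\<close> through
  lower coefficients, so only the coefficient of \<open>q\<close> is free.\<close>

lemma qD_eq_mult_imp_eq_0:
  fixes f g :: "real fps"
  assumes "qD f = f * g" "fps_nth g 0 = 1" "fps_nth f 1 = 0"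
  shows "f = 0"
proof (rule fps_ext)
  fix n
  show "fps_nth f n = fps_nth 0 n"
  proof (induction n rule: less_induct)
    case (less n)
    have "real n * fps_nth f n = fps_nth (f * g) n"
      using assms(1) by (metis qD_nth)
    also have "\<dots> = (\<Sum>i\<in>insert n {..<n}. fps_nth f i * fps_nth g (n - i))"
      by (simp add: fps_mult_nth atLeast0AtMost lessThan_Suc [symmetric] lessThan_Suc_atMost)
    also have "\<dots> = fps_nth f n"
      using less by (simp add: assms(2))
    finally have "(real n - 1) * fps_nth f n = 0" by (simp add: algebra_simps)
    thus ?case using assms(3) by (cases "n = 1") auto
  qed
qed

subsection \<open>The discriminant\<close>

text \<open>Logarithmic differentiation: \<open>q\<close> itself contributes 1, and each factor
  \<open>(1 - q^k)^24\<close> adds \<open>- 24 k * geom k\<close>.\<close>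

lemma qD_euler_product:
  "qD (fps_X * (\<Prod>r\<le>N. (1 - fps_X ^ Suc r) ^ 24)) = fps_X * (\<Prod>r\<le>N. (1 - fps_X ^ Suc r) ^ 24) *
    (1 - 24 * (\<Sum>m=1..Suc N. of_nat m * geom m) :: 'a::comm_ring_1 fps)"
proof (induction N)
  have step: "qD (f * (1 - fps_X ^ Suc k) ^ 24) =
      f * (1 - fps_X ^ Suc k) ^ 24 * (c - 24 * (of_nat (Suc k) * geom (Suc k)))"
    if "qD f = f * c" for f c :: "'a fps" and k
  proof -
    let ?h = "1 - fps_X ^ Suc k :: 'a fps"
    have "qD (f * ?h ^ 24) = qD f * ?h ^ 24 + f * (24 * (?h ^ 23 * qD ?h))"
      by (simp add: qD_mult qD_power mult.assoc)
    also have "qD ?h = - of_nat (Suc k) * geom (Suc k) * ?h"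
      by (rule qD_one_minus_X_power) simp
    also have "qD f * ?h ^ 24 + f * (24 * (?h ^ 23 * (- of_nat (Suc k) * geom (Suc k) * ?h))) =
        f * (?h ^ 24 * c) - f * (24 * ((?h ^ 23 * ?h) * (of_nat (Suc k) * geom (Suc k))))"
      unfolding that by (simp only: mult_ac minus_mult_left [symmetric] minus_mult_right [symmetric]
        diff_conv_add_uminus)
    also have "?h ^ 23 * ?h = ?h ^ 24"
      by (simp only: power_Suc2 [symmetric]) simp
    finally show ?thesis
      by (simp only: right_diff_distrib mult_ac)
  qed
  {
    case 0
    have "qD (fps_X) = (fps_X * 1 :: 'a fps)" by (simp add: qD_def)
    from step[OF this, of 0] show ?case by simp
  next
    case (Suc N)
    from step[OF Suc, of "Suc N"] show ?case
      by (simp only: prod.atMost_Suc mult.assoc) (simp add: algebra_simps)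
  }
qed

lemma ramanujan_tau_eventually:
  "\<forall>\<^sub>F N in sequentially. fps_nth (fps_X * (\<Prod>r\<le>N. (1 - fps_X ^ Suc r) ^ 24)) n = ramanujan_tau n"
proof -
  let ?f = "\<lambda>r. (1 - fps_X ^ Suc r) ^ 24 :: int fps"
  \<comment> \<open>\<open>has_prod\<close> may skip finitely many vanishing factors; excluding
    zeros gives convergence of the partial products from index 0.\<close>
  have "?f i \<noteq> 0" for i
    using one_minus_X_power_nonzero[of "Suc i", where 'a = int] by simp
  hence "raw_has_prod ?f 0 (\<Prod>r. ?f r)"
    using ramanujan_tau_product_converges unfolding has_prod_def by blast
  hence "(\<lambda>N. \<Prod>r\<le>N. ?f r) \<longlonglongrightarrow> (\<Prod>r. ?f r)"
    by (simp add: raw_has_prod_def)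
  \<comment> \<open>The factor \<open>fps_X\<close> shifts degrees by one. For \<open>n = 0\<close>,
    where \<open>n - 1\<close> is 0, both coefficients in question are zero anyway.\<close>
  hence "\<forall>\<^sub>F N in sequentially. fps_nth (\<Prod>r\<le>N. ?f r) (n - 1) = fps_nth (\<Prod>r. ?f r) (n - 1)"
    unfolding tendsto_fps_iff by blast
  thus ?thesis
    by eventually_elim (simp add: ramanujan_tau_def)
qed

lemma ramanujan_tau_1: "ramanujan_tau 1 = 1"
proof -
  obtain N where "fps_nth (fps_X * (\<Prod>r\<le>N. (1 - fps_X ^ Suc r) ^ 24)) 1 = ramanujan_tau 1"
    using eventually_happens'[OF sequentially_bot ramanujan_tau_eventually] by blast
  moreover have "fps_nth (\<Prod>r\<le>N. (1 - fps_X ^ Suc r) ^ 24 :: int fps) 0 = 1"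
    by (induction N) (simp_all add: fps_power_zeroth)
  ultimately show ?thesis by simp
qed

text \<open>The coefficient form of \<open>q \<Delta>' = E2 \<Delta>\<close>. Degree
  \<open>n\<close> involves only finitely many coefficients, so a single large partial product
  suffices and no infinite product is differentiated.\<close>

lemma ramanujan_tau_recurrence:
  "int n * ramanujan_tau n =
    (\<Sum>i=0..n. ramanujan_tau i * fps_nth (1 - 24 * lambert of_nat :: int fps) (n - i))"
proof -
  let ?p = "\<lambda>N. fps_X * (\<Prod>r\<le>N. (1 - fps_X ^ Suc r) ^ 24) :: int fps"
  have "\<forall>\<^sub>F N in sequentially. \<forall>i\<in>{0..n}. fps_nth (?p N) i = ramanujan_tau i"
    by (intro eventually_ball_finite) (use ramanujan_tau_eventually in auto)
  hence "\<forall>\<^sub>F N in sequentially. n \<le> N \<and> (\<forall>i\<in>{0..n}. fps_nth (?p N) i = ramanujan_tau i)"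
    using eventually_ge_at_top[of n] by eventually_elim auto
  then obtain N where N: "n \<le> N" "\<And>i. i \<in> {0..n} \<Longrightarrow> fps_nth (?p N) i = ramanujan_tau i"
    using eventually_happens by fastforce
  have lam: "fps_nth (1 - 24 * (\<Sum>m=1..Suc N. of_nat m * geom m)) j =
      fps_nth (1 - 24 * lambert of_nat :: int fps) j" if "j \<le> n" for j
    using that N(1) lambert_nth[of j "Suc N" "of_nat :: nat \<Rightarrow> int"]
    by (simp add: fps_nth_numeral_mult fps_sum_nth flip: fps_of_nat del: sum.cl_ivl_Suc of_nat_Suc)
  have "int n * ramanujan_tau n = fps_nth (qD (?p N)) n"
    using N(2)[of n] by (simp only: qD_nth) simp
  also have "\<dots> = (\<Sum>i=0..n. fps_nth (?p N) i *
      fps_nth (1 - 24 * (\<Sum>m=1..Suc N. of_nat m * geom m)) (n - i))"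
    unfolding qD_euler_product fps_mult_nth[of "?p N"] ..
  also have "\<dots> = (\<Sum>i=0..n. ramanujan_tau i * fps_nth (1 - 24 * lambert of_nat :: int fps) (n - i))"
    by (intro sum.cong refl) (simp only: N(2) lam diff_le_self)
  finally show ?thesis .
qed

definition Delta :: "real fps"
  where "Delta = Abs_fps (\<lambda>n. real_of_int (ramanujan_tau n))"

lemma qD_Delta: "qD Delta = Delta * E2"
proof (rule fps_ext)
  fix n
  have E2: "fps_nth E2 k = real_of_int (fps_nth (1 - 24 * lambert of_nat) k)" for k
    by (simp add: E2_def sigma_fps_nth lambert_def fps_nth_numeral_mult geom_nth)
  have "fps_nth (qD Delta) n = real_of_int (int n * ramanujan_tau n)"
    by (simp add: qD_nth Delta_def)
  also have "\<dots> = fps_nth (Delta * E2) n"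
    unfolding ramanujan_tau_recurrence
      by (simp only: fps_mult_nth E2 Delta_def fps_nth_Abs_fps of_int_sum of_int_mult)
  finally show "fps_nth (qD Delta) n = fps_nth (Delta * E2) n" .
qed

lemma Delta_eq: "1728 * Delta = E4 ^ 3 - E6 ^ 2"
proof -
  let ?f = "1728 * Delta - (E4 ^ 3 - E6 ^ 2)"
  have "qD ?f = ?f * E2"
    unfolding qD_diff[of "1728 * Delta"] qD_discriminant
    by (simp add: qD_mult qD_numeral qD_Delta left_diff_distrib mult.assoc)
  moreover have "fps_nth E2 0 = 1"
    by (simp add: E2_def sigma_fps_nth_0)
  \<comment> \<open>The coefficient of \<open>q\<close> in \<open>E4 ^ 3 - E6 ^ 2\<close> is
    \<open>3 * 240 + 2 * 504 = 1728\<close>.\<close>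
  moreover have "fps_nth ?f 1 = 0"
    using ramanujan_tau_1
    by (simp add: power3_eq_cube power2_eq_square fps_mult_nth E4_def E6_def sigma_fps_nth_0
      sigma_fps_nth_1
      Delta_def fps_numeral_nth)
  ultimately have "?f = 0" by (rule qD_eq_mult_imp_eq_0)
  thus ?thesis by simp
qed

subsection \<open>Relations of level two\<close>

definition dil :: "real fps \<Rightarrow> real fps"
  where "dil f = f oo fps_X ^ 2"

lemma dil_add: "dil (f + g) = dil f + dil g"
  and dil_diff: "dil (f - g) = dil f - dil g"
  and dil_mult: "dil (f * g) = dil f * dil g"
  and dil_power: "dil (f ^ k) = dil f ^ k"
  and dil_1: "dil 1 = 1"
  and dil_numeral: "dil (numeral m) = numeral m"
  by (simp_all add: dil_def fps_compose_add_distrib fps_compose_sub_distrib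
    fps_compose_mult_distrib fps_compose_power)

lemmas dil_simps = dil_add dil_diff dil_mult dil_power dil_1 dil_numeral

text \<open>The chain rule; it carries Ramanujan's equations over to the argument
  \<open>q^2\<close>.\<close>

lemma qD_dil: "qD (dil f) = 2 * dil (qD f)"
proof -
  have "fps_deriv (dil f) = (fps_deriv f oo fps_X ^ 2) * (2 * fps_X)"
    unfolding dil_def by (subst fps_compose_deriv) (simp_all add: fps_deriv_power')
  moreover have "dil (qD f) = fps_X ^ 2 * (fps_deriv f oo fps_X ^ 2)"
    unfolding dil_def qD_def by (subst fps_compose_mult_distrib) simp_all
  ultimately show ?thesis
    by (simp add: qD_def power2_eq_square mult_ac)
qed

lemma dil_nth: "fps_nth (dil f) n = (if even n then fps_nth f (n div 2) else 0)"
proof -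
  have "fps_nth (dil f) n = (\<Sum>i=0..n. fps_nth f i * of_bool (n = 2 * i))"
    unfolding dil_def fps_compose_nth power_mult [symmetric]
    by (simp add: fps_X_power_nth of_bool_def)
  also have "\<dots> = (\<Sum>i\<in>{i. i \<in> {0..n} \<and> n = 2 * i}. fps_nth f i)"
    by (subst sum.inter_filter) (simp_all add: of_bool_def if_distrib cong: if_cong)
  also have "{i. i \<in> {0..n} \<and> n = 2 * i} = (if even n then {n div 2} else {})"
    by auto
  finally show ?thesis by simp
qed

text \<open>The modular form of weight two for the group \<open>Gamma_0(2)\<close>, normalised to
  constant term 1; the quasimodular parts of the two \<open>E2\<close> cancel.\<close>

definition level2_E2 :: "real fps" where "level2_E2 = 2 * dil E2 - E2"

text \<open>By Ramanujan's differential equations the deviations from the level-two relations satisfy a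
  linear system of differential equations; its indicial polynomial is \<open>n\<^sup>2 (n - 2)\<close>.\<close>

lemma linear_system_vanishes:
  fixes f g h :: "real fps"
  assumes f: "6 * qD f = f * a11 + g * 2 + h * 2"
    and g: "4 * qD g = f * a21 + g * a22"
    and h: "4 * qD h = f * a31 + g * a32 + h * a33"
    and a: "fps_nth a11 0 = 9" "fps_nth a21 0 = - 3" "fps_nth a22 0 = - 2"
      "fps_nth a31 0 = 6" "fps_nth a32 0 = - 4" "fps_nth a33 0 = 4"
    and init: "\<And>n. n \<le> 2 \<Longrightarrow> fps_nth f n = 0 \<and> fps_nth g n = 0 \<and> fps_nth h n = 0"
  shows "f = 0 \<and> g = 0 \<and> h = 0"
proof -
  have "fps_nth f n = 0 \<and> fps_nth g n = 0 \<and> fps_nth h n = 0" for n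
  proof (induction n rule: less_induct)
    case (less n)
    show ?case
    proof (cases "n \<le> 2")
      case False
      define u v w where "u = fps_nth f n" and "v = fps_nth g n" and "w = fps_nth h n"
      \<comment> \<open>The lower coefficients vanish by induction, so only the constant terms of
        the coefficient series enter, and the system becomes three linear equations over the
        reals.\<close>
      have top: "fps_nth (p * c) n = fps_nth p n * fps_nth c 0"
        if "\<And>m. m < n \<Longrightarrow> fps_nth p m = 0" for p c :: "real fps"
      proof -
        have "fps_nth (p * c) n = (\<Sum>i\<in>insert n {..<n}. fps_nth p i * fps_nth c (n - i))"
          by (simp add: fps_mult_nth atLeast0AtMost lessThan_Suc [symmetric] lessThan_Suc_atMost)
        thus ?thesis using that by simp
      qed
      have zero: "fps_nth f m = 0" "fps_nth g m = 0" "fps_nth h m = 0" if "m < n" for m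
        using less[OF that] by auto
      have e1: "6 * (real n * u) = 9 * u + 2 * v + 2 * w"
        using arg_cong[OF f, of "\<lambda>p. fps_nth p n"]
        by (simp add: fps_nth_numeral_mult qD_nth top zero a u_def v_def w_def fps_numeral_nth)
      have e2: "4 * (real n * v) = - 3 * u - 2 * v"
        using arg_cong[OF g, of "\<lambda>p. fps_nth p n"]
        by (simp add: fps_nth_numeral_mult qD_nth top zero a u_def v_def w_def)
      have e3: "4 * (real n * w) = 6 * u - 4 * v + 4 * w"
        using arg_cong[OF h, of "\<lambda>p. fps_nth p n"]
        by (simp add: fps_nth_numeral_mult qD_nth top zero a u_def v_def w_def)
      have "real n ^ 2 * (real n - 2) * u = 0"
        using e1 e2 e3 by algebra
      hence u: "u = 0" using False by auto
      have "(4 * real n + 2) * v = 0" using e2 u by (simp add: algebra_simps)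
      hence v: "v = 0" by (simp add: add_eq_0_iff)
      have "w = 0" using e1 u v by simp
      with u v show ?thesis by (simp add: u_def v_def w_def)
    qed (use init in blast)
  qed
  thus ?thesis by (simp add: fps_eq_iff)
qed

text \<open>The deviations \<open>f\<close>, \<open>g\<close>, \<open>h\<close> satisfy the system
  above, by Ramanujan's equations at \<open>q\<close> and at \<open>q^2\<close>, and their
  coefficients up to \<open>q^2\<close> are zero by computation.\<close>

lemma level_two_relations:
  "4 * dil E4 = 5 * level2_E2 ^ 2 - E4"
  "E6 = 4 * level2_E2 ^ 3 - 3 * level2_E2 * E4"
  "8 * dil E6 = 11 * level2_E2 ^ 3 - 3 * level2_E2 * E4"
proof -
  define F2 F4 F6 where "F2 = dil E2" and "F4 = dil E4" and "F6 = dil E6"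
  have D: "6 * qD F2 = F2 ^ 2 - F4" "3 * qD F4 = 2 * (F2 * F4 - F6)" "qD F6 = F2 * F6 - F4 ^ 2"
    using arg_cong[OF qD_E2, of dil] arg_cong[OF qD_E4, of dil] arg_cong[OF qD_E6, of dil]
    unfolding F2_def F4_def F6_def qD_dil dil_simps by (algebra, algebra, simp add: algebra_simps)
  define f g h where "f = 5 * level2_E2 ^ 2 - E4 - 4 * F4"
    and "g = E6 - 4 * level2_E2 ^ 3 + 3 * level2_E2 * E4"
    and "h = 8 * F6 - 11 * level2_E2 ^ 3 + 3 * level2_E2 * E4"
  have DA: "12 * qD level2_E2 = 4 * (F2 ^ 2 - F4) - (E2 ^ 2 - E4)"
    using D(1) qD_E2 unfolding level2_E2_def qD_simps F2_def by algebra
  have F2: "2 * F2 = level2_E2 + E2" by (simp add: level2_E2_def F2_def)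
  have nth: "fps_nth F2 0 = 1" "fps_nth F2 1 = 0" "fps_nth F2 2 = - 24"
    "fps_nth F4 0 = 1" "fps_nth F4 1 = 0" "fps_nth F4 2 = 240"
    "fps_nth F6 0 = 1" "fps_nth F6 1 = 0" "fps_nth F6 2 = - 504"
    "fps_nth E2 0 = 1" "fps_nth E2 1 = - 24" "fps_nth E2 2 = - 72"
    "fps_nth E4 0 = 1" "fps_nth E4 1 = 240" "fps_nth E4 2 = 2160"
    "fps_nth E6 0 = 1" "fps_nth E6 1 = - 504" "fps_nth E6 2 = - 16632"
    by (simp_all add: F2_def F4_def F6_def dil_nth E2_def E4_def E6_def fps_nth_numeral_mult
      sigma_fps_nth_0 sigma_fps_nth_1 sigma_fps_nth_2)
  have nthA: "fps_nth level2_E2 0 = 1" "fps_nth level2_E2 1 = 24" "fps_nth level2_E2 2 = 24"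
    using nth(1-3,10-12) by (simp_all add: level2_E2_def F2_def fps_nth_numeral_mult
      fps_numeral_nth)
  have mult_nth: "fps_nth (p * q) 0 = fps_nth p 0 * fps_nth q 0"
    "fps_nth (p * q) 1 = fps_nth p 0 * fps_nth q 1 + fps_nth p 1 * fps_nth q 0"
    "fps_nth (p * q) 2 = fps_nth p 0 * fps_nth q 2 + fps_nth p 1 * fps_nth q 1 + fps_nth p 2
      * fps_nth q 0"
    for p q :: "real fps"
    by (simp_all add: fps_mult_nth numeral_2_eq_2)
  have "f = 0 \<and> g = 0 \<and> h = 0"
  proof (rule linear_system_vanishes)
    show "6 * qD f = f * (7 * level2_E2 + 2 * E2) + g * 2 + h * 2"
      using D DA F2 qD_E4 qD_E6 unfolding f_def g_def h_def power2_eq_square power3_eq_cube qD_simps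
      by algebra
    show "4 * qD g = f * (E4 - 4 * level2_E2 ^ 2) + g * (2 * E2 - 4 * level2_E2)"
      using D DA F2 qD_E4 qD_E6 unfolding f_def g_def h_def power2_eq_square power3_eq_cube qD_simps
      by algebra
    \<comment> \<open>The equation is quadratic in \<open>f\<close>; absorbing one \<open>f\<close>
      into the coefficient is harmless, as the constant term of \<open>f\<close> is 0 and
      \<open>9 - 3 = 6\<close> remains.\<close>
    show "4 * qD h = f * (9 * level2_E2 ^ 2 - 3 * E4 - 2 * f) + g * (- 4 * level2_E2) + h
      * (2 * level2_E2 + 2 * E2)"
      using D DA F2 qD_E4 qD_E6 unfolding f_def g_def h_def power2_eq_square power3_eq_cube qD_simps
      by algebra
    show "fps_nth f n = 0 \<and> fps_nth g n = 0 \<and> fps_nth h n = 0" if "n \<le> 2" for n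
    proof -
      have "n = 0 \<or> n = 1 \<or> n = 2" using that by auto
      thus ?thesis
        unfolding f_def g_def h_def power2_eq_square power3_eq_cube mult.assoc
          fps_add_nth fps_sub_nth fps_nth_numeral_mult
        by (elim disjE) (simp_all only: mult_nth nth nthA, simp_all)
    qed
  qed (simp_all add: f_def power2_eq_square mult_nth fps_nth_numeral_mult nth nthA)
  thus "4 * dil E4 = 5 * level2_E2 ^ 2 - E4"
    "E6 = 4 * level2_E2 ^ 3 - 3 * level2_E2 * E4"
    "8 * dil E6 = 11 * level2_E2 ^ 3 - 3 * level2_E2 * E4"
    by (simp_all add: f_def g_def h_def F4_def F6_def algebra_simps)
qed

section \<open>Divisor series with alternating signs\<close>

definition signed_sigma_fps :: "nat \<Rightarrow> real fps"
  where "signed_sigma_fps k = lambert (\<lambda>d. (- 1) ^ d * real d ^ k)"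

text \<open>Adding \<open>sigma_fps k\<close> removes the odd divisors and doubles the even ones.
  Writing these as \<open>2 * m\<close> turns \<open>geom (2 * m)\<close> into a dilation and
  produces the factor \<open>2 ^ Suc k\<close>.\<close>

lemma signed_sigma_fps_eq: "signed_sigma_fps k = 2 ^ Suc k * dil (sigma_fps k) - sigma_fps k"
proof (rule fps_ext)
  fix n
  have "fps_nth (signed_sigma_fps k) n + fps_nth (sigma_fps k) n =
      (\<Sum>m=1..n. ((- 1) ^ m * real m ^ k + real m ^ k) * fps_nth (geom m) n)"
    unfolding signed_sigma_fps_def lambert_def fps_nth_Abs_fps sigma_fps_nth
      by (simp add: sum.distrib distrib_right)
  also have "\<dots> = (\<Sum>m | m \<in> {1..n} \<and> even m. 2 * real m ^ k * fps_nth (geom m) n)"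
    by (subst sum.inter_filter) (auto intro!: sum.cong)
  also have "\<dots> = fps_nth (2 ^ Suc k * dil (sigma_fps k)) n"
  proof (cases "even n")
    case True
    then obtain j where n: "n = 2 * j" by blast
    have "(\<Sum>m | m \<in> {1..n} \<and> even m. 2 * real m ^ k * fps_nth (geom m) n) =
        (\<Sum>m=1..j. 2 * real (2 * m) ^ k * fps_nth (geom (2 * m)) n)"
      by (rule sum.reindex_bij_witness[of _ "\<lambda>m. 2 * m" "\<lambda>m. m div 2"]) (auto simp: n)
    also have "\<dots> = 2 ^ Suc k * (\<Sum>m=1..j. real m ^ k * fps_nth (geom m) j)"
      by (auto simp: n geom_nth sum_distrib_left power_mult_distrib intro!: sum.cong)
    also have "\<dots> = fps_nth (2 ^ Suc k * dil (sigma_fps k)) n"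
      by (simp add: numeral_fps_const fps_const_power dil_nth sigma_fps_nth n mult.assoc)
    finally show ?thesis .
  next
    case False
    hence "(\<Sum>m | m \<in> {1..n} \<and> even m. 2 * real m ^ k * fps_nth (geom m) n) = 0"
      by (intro sum.neutral) (auto simp: geom_nth)
    thus ?thesis using False
      by (simp add: numeral_fps_const fps_const_power dil_nth mult.assoc)
  qed
  finally show "fps_nth (signed_sigma_fps k) n
    = fps_nth (2 ^ Suc k * dil (sigma_fps k) - sigma_fps k) n"
    by (simp add: algebra_simps)
qed

text \<open>In terms of \<open>E4\<close> and \<open>level2_E2\<close> both sides are polynomials; comparing them determines the
  coefficients on the right, with common denominator 294840.\<close>

lemma level_two_combination:
  "294840 * 259 * Delta + 36855 * sigma_fps 11 - 2829645
    * (17 * sigma_fps 3 + 8 * sigma_fps 5 + 2 * sigma_fps 7)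
    + 90548640 * (signed_sigma_fps 7 * signed_sigma_fps 3 - signed_sigma_fps 5 ^ 2) =
   dil (928704 * E4 ^ 3 + 663360 * E6 ^ 2 - 3018288 * E4 ^ 2 - 3206931 * E4 + 2874560 * E6
     + 1758595)"
proof -
  define q r where "q = dil E4" and "r = dil E6"
  have q: "4 * q = 5 * level2_E2 ^ 2 - E4" and E6: "E6 = 4 * level2_E2 ^ 3 - 3 * level2_E2 * E4"
    and r: "8 * r = 11 * level2_E2 ^ 3 - 3 * level2_E2 * E4"
    unfolding q_def r_def by (fact level_two_relations)+
  have S3: "240 * sigma_fps 3 = E4 - 1" and S5: "504 * sigma_fps 5 = 1 - E6"
    by (simp_all add: E4_def E6_def)
  have "240 * dil (sigma_fps 3) = q - 1" "504 * dil (sigma_fps 5) = 1 - r"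
    "480 * dil (sigma_fps 7) = q ^ 2 - 1"
    using arg_cong[OF S3, of dil] arg_cong[OF S5, of dil] arg_cong[OF sigma_fps_7_eq, of dil]
    by (simp_all add: dil_simps q_def r_def)
  moreover have "signed_sigma_fps 3 = 16 * dil (sigma_fps 3) - sigma_fps 3"
    "signed_sigma_fps 5 = 64 * dil (sigma_fps 5) - sigma_fps 5"
    "signed_sigma_fps 7 = 256 * dil (sigma_fps 7) - sigma_fps 7"
    by (simp_all add: signed_sigma_fps_eq)
  ultimately have T: "240 * signed_sigma_fps 3 = 16 * q - E4 - 15"
    "504 * signed_sigma_fps 5 = 63 - 64 * r + E6"
    "480 * signed_sigma_fps 7 = 256 * q ^ 2 - E4 ^ 2 - 255"
    using S3 S5 sigma_fps_7_eq by algebra+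
  \<comment> \<open>The products are prepared with cleared denominators,
    \<open>115200 = 240 * 480\<close> and \<open>254016 = 504 ^ 2\<close>, so that they enter the
    final elimination linearly.\<close>
  have T73: "115200 * (signed_sigma_fps 7 * signed_sigma_fps 3)
    = (256 * q ^ 2 - E4 ^ 2 - 255) * (16 * q - E4 - 15)"
    using T by algebra
  have T55: "254016 * signed_sigma_fps 5 ^ 2 = (63 - 64 * r + E6) ^ 2"
    using T by algebra
  show ?thesis
    unfolding dil_simps q_def [symmetric] r_def [symmetric]
    using Delta_eq S3 S5 sigma_fps_7_eq sigma_fps_11_eq T73 T55 q r E6 by algebra
qed

lemma dil_nth_odd: "odd n \<Longrightarrow> fps_nth (dil f) n = 0"
  by (simp add: dil_nth)

text \<open>A dilated series has no odd coefficients; dividing the rest by 294840 gives the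
  constants of the theorem.\<close>

lemma level_two_combination_nth:
  assumes "odd n"
  shows "259 * real_of_int (ramanujan_tau n) + 1 / 8 * fps_nth (sigma_fps 11) n
    - 691 / 72 * (17 * fps_nth (sigma_fps 3) n + 8 * fps_nth (sigma_fps 5) n + 2
      * fps_nth (sigma_fps 7) n)
    + 691 * 4 / 9 * fps_nth (signed_sigma_fps 7 * signed_sigma_fps 3 - signed_sigma_fps 5 ^ 2) n
      = 0"
proof -
  have "294840 * 259 * real_of_int (ramanujan_tau n) + 36855 * fps_nth (sigma_fps 11) n
      - 2829645 * (17 * fps_nth (sigma_fps 3) n + 8 * fps_nth (sigma_fps 5) n + 2
        * fps_nth (sigma_fps 7) n)
      + 90548640 * fps_nth (signed_sigma_fps 7 * signed_sigma_fps 3 - signed_sigma_fps 5 ^ 2) n = 0"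
    using arg_cong[OF level_two_combination, of "\<lambda>f. fps_nth f n"]
    by (simp add: fps_nth_numeral_mult dil_nth_odd[OF assms] mult.assoc Delta_def)
  thus ?thesis by (simp add: field_simps)
qed

section \<open>The double sum as a coefficient of a convolution\<close>

lemma card_linear_representations:
  assumes "a > 0" "b > 0"
  shows "(\<Sum>(x, y) | x \<ge> 1 \<and> y \<ge> 1 \<and> a * x + b * y = n. 1) = fps_nth (geom a * geom b :: real fps) n"
proof -
  have "fps_nth (geom a * geom b :: real fps) n =
      (\<Sum>i=0..n. if 0 < i \<and> a dvd i \<and> 0 < n - i \<and> b dvd n - i then 1 else 0)"
    unfolding fps_mult_nth geom_nth by (intro sum.cong refl) auto
  also have "\<dots> = (\<Sum>i | i \<in> {0..n} \<and> 0 < i \<and> a dvd i \<and> 0 < n - i \<and> b dvd n - i. 1)"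
    by (rule sum.inter_filter [symmetric]) simp
  \<comment> \<open>A solution corresponds to the splitting point \<open>i = a * x\<close>, with
    \<open>n - i = b * y\<close>.\<close>
  also have "\<dots> = (\<Sum>(x, y) | x \<ge> 1 \<and> y \<ge> 1 \<and> a * x + b * y = n. 1)"
    by (rule sum.reindex_bij_witness[of _ "\<lambda>(x, y). a * x" "\<lambda>i. (i div a, (n - i) div b)"])
      (use assms in \<open>auto simp: dvd_def Suc_le_eq intro!: gr0I\<close>)
  finally show ?thesis ..
qed

text \<open>The weight is symmetric, vanishes for equal arguments, and expands by
  \<open>(a b)^3 (a^2 - b^2)^2 = a^7 b^3 - 2 a^5 b^5 + a^3 b^7\<close>.\<close>

lemma signed_convolution:
  "(\<Sum>(m1, m2) | m1 > m2 \<and> m2 \<ge> 1 \<and> m1 + m2 \<le> n \<and> gcd m1 m2 dvd n.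
      (- 1) ^ (m1 + m2) * (real m1 * real m2) ^ 3 * ((real m1) ^ 2 - (real m2) ^ 2) ^ 2
      * (\<Sum>(y1, y2) | y1 \<ge> 1 \<and> y2 \<ge> 1 \<and> m1 * y1 + m2 * y2 = n. 1)) =
   fps_nth (signed_sigma_fps 7 * signed_sigma_fps 3 - signed_sigma_fps 5 ^ 2) n"
  (is "sum ?t ?I = _")
proof -
  define w where "w a b = (- 1) ^ (a + b) * (real a * real b) ^ 3 * (real a ^ 2 - real b ^ 2) ^ 2"
    for a b
  define G where "G a b = w a b * fps_nth (geom a * geom b :: real fps) n" for a b
  have G_sym: "G a b = G b a" for a b
    by (simp add: G_def w_def power2_commute[of "real a ^ 2"] mult.commute add.commute)
  have w: "w a b = ((- 1) ^ a * real a ^ 7) * ((- 1) ^ b * real b ^ 3)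
      + ((- 1) ^ a * real a ^ 3) * ((- 1) ^ b * real b ^ 7)
      - 2 * (((- 1) ^ a * real a ^ 5) * ((- 1) ^ b * real b ^ 5))" for a b
    by (simp add: w_def power_add algebra_simps eval_nat_numeral)
  have "sum ?t ?I = (\<Sum>(a, b)\<in>?I. G a b)"
  proof (rule sum.cong[OF refl])
    fix p assume "p \<in> ?I"
    then obtain a b where p: "p = (a, b)" and "b < a" "1 \<le> b" by auto
    thus "?t p = (case p of (a, b) \<Rightarrow> G a b)"
      unfolding p prod.case G_def w_def by (subst card_linear_representations) auto
  qed
  also have "\<dots> = (\<Sum>(a, b) | (a, b) \<in> {1..n} \<times> {1..n} \<and> b < a. G a b)"
  proof (rule sum.mono_neutral_left)
    show "finite {(a, b). (a, b) \<in> {1..n} \<times> {1..n} \<and> b < a}"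
      by (rule finite_subset[of _ "{1..n} \<times> {1..n}"]) auto
    show "\<forall>i\<in>{(a, b). (a, b) \<in> {1..n} \<times> {1..n} \<and> b < a} - ?I.
        (case i of (a, b) \<Rightarrow> G a b) = 0"
    proof
      fix i
      assume "i \<in> {(a, b). (a, b) \<in> {1..n} \<times> {1..n} \<and> b < a} - ?I"
      then obtain a b where i: "i = (a, b)" and ab: "a \<in> {1..n}" "b \<in> {1..n}" "b < a"
        and *: "\<not> (b < a \<and> 1 \<le> b \<and> a + b \<le> n \<and> gcd a b dvd n)" by blast
      have "{(x, y). x \<ge> 1 \<and> y \<ge> 1 \<and> a * x + b * y = n} = {}" if "a + b \<le> n"
      proof -
        have "\<not> gcd a b dvd n" using that * ab by simp
        moreover have "gcd a b dvd a * x + b * y" for x y by simp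
        ultimately show ?thesis by blast
      qed
      hence "(\<Sum>(x, y) | x \<ge> 1 \<and> y \<ge> 1 \<and> a * x + b * y = n. 1 :: real) = 0" if "a + b \<le> n"
        using that by (simp only: sum.empty)
      hence "fps_nth (geom a * geom b :: real fps) n = 0"
        using ab geom_mult_nth_eq_0[of a b n] card_linear_representations[of a b n]
        by (cases "a + b \<le> n") auto
      thus "(case i of (a, b) \<Rightarrow> G a b) = 0" by (simp add: G_def i)
    qed
  qed auto
  also have "\<dots> = (\<Sum>b=1..n. \<Sum>a=b+1..n. G a b)"
    unfolding sum.Sigma[OF finite_atLeastAtMost ballI[OF finite_atLeastAtMost]]
    by (rule sum.reindex_bij_witness[of _ "\<lambda>(a, b). (b, a)" "\<lambda>(a, b). (b, a)"]) auto
  \<comment> \<open>Doubling supplies the opposite triangle by symmetry, and the diagonal may be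
    added because \<open>w b b = 0\<close>.\<close>
  finally have "2 * sum ?t ?I = (\<Sum>b=1..n. \<Sum>a=b+1..n. G a b) + (\<Sum>b=1..n. \<Sum>a=b+1..n. G b a)"
    using G_sym by simp
  also have "\<dots> = (\<Sum>a=1..n. \<Sum>b=1..n. G a b)"
    unfolding sum_square_split by (simp add: G_def w_def)
  also have "\<dots> = fps_nth (signed_sigma_fps 7 * signed_sigma_fps 3) n
    + fps_nth (signed_sigma_fps 3 * signed_sigma_fps 7) n - 2 * fps_nth (signed_sigma_fps 5
      * signed_sigma_fps 5) n"
    unfolding signed_sigma_fps_def lambert_mult_nth sum_distrib_left sum.distrib [symmetric]
      sum_subtractf [symmetric]
    by (intro sum.cong refl) (simp add: G_def w algebra_simps)
  finally show ?thesis
    by (simp add: mult.commute power2_eq_square)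
qed

theorem theorem1p9:
  fixes n :: nat
  assumes "n \<ge> 3" and "odd n"
  shows "259 * real_of_int (ramanujan_tau n) =
      - (1 / 2 ^ 3) * (\<Sum>d | d dvd n \<and> d > 0. real d ^ 11)
      + 691 / (2 ^ 3 * 3 ^ 2)
          * (\<Sum>d | d dvd n \<and> d > 0. real d ^ 3 * (17 + 8 * real d ^ 2 + 2 * real d ^ 4))
      - 691 * 2 ^ 2 / 3 ^ 2
          * (\<Sum>(m1, m2) | m1 > m2 \<and> m2 \<ge> 1 \<and> m1 + m2 \<le> n \<and> gcd m1 m2 dvd n.
               (- 1) ^ (m1 + m2) * (real m1 * real m2) ^ 3 * ((real m1) ^ 2 - (real m2) ^ 2) ^ 2
               * (\<Sum>(y1, y2) | y1 \<ge> 1 \<and> y2 \<ge> 1 \<and> m1 * y1 + m2 * y2 = n. 1))"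
proof -
  have S: "fps_nth (sigma_fps k) n = (\<Sum>d | d dvd n \<and> d > 0. real d ^ k)" for k
    unfolding sigma_fps_def by (rule lambert_nth_divisors) (use assms in simp)
  have "(\<Sum>d | d dvd n \<and> d > 0. real d ^ 3 * (17 + 8 * real d ^ 2 + 2 * real d ^ 4)) =
      17 * fps_nth (sigma_fps 3) n + 8 * fps_nth (sigma_fps 5) n + 2 * fps_nth (sigma_fps 7) n"
    unfolding S sum_distrib_left sum.distrib [symmetric]
    by (intro sum.cong refl) (simp add: algebra_simps flip: power_add)
  thus ?thesis
    unfolding signed_convolution S [symmetric]
    using level_two_combination_nth[OF assms(2)] by simp
qed

end
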